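(* Let $p:X\to Y$ be a continuous map of topological spaces. Then $p$ is a homotopy equivalence if and only if $p$ has the homotopy extension lifting property (HELP) for all closed cofibrations $i:A\to B$ of topological spaces.
   Context: A closed cofibration is a map $i:A\to B$ of topological spaces that has the homotopy extension property with respect to all spaces (a Hurewicz cofibration) and is a closed embedding. The map $p:X\to Y$ has the HELP for $i:A\to B$ if for all continuous maps $f_A:A\to X$ and $g:B\to Y$ (the square formed by $f_A,i,p,g$ is not required to commute) and each homotopy $h_A:A\times[0,1]\to Y$ from $p\circ f_A$ to $g\circ i$, there are a continuous map $f:B\to X$ and a homotopy $h:B\times[0,1]\to Y$ from $p\circ f$ to $g$ such that $f\circ i=f_A$ and $h\circ(i\times\mathrm{id}_{[0,1]})=h_A$. *)

theory Defs
  imports "HOL-Analysis.Homotopy"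
begin

abbreviation unit_interval :: "real topology"
  where "unit_interval \<equiv> top_of_set {0..1}"

text \<open>The data of \<^const>\<open>homotopy_equivalent_space\<close>, as a property of the map.\<close>

definition homotopy_equivalence :: "'a topology \<Rightarrow> 'b topology \<Rightarrow> ('a \<Rightarrow> 'b) \<Rightarrow> bool"
  where "homotopy_equivalence X Y p \<longleftrightarrow>
    continuous_map X Y p \<and>
    (\<exists>q. continuous_map Y X q \<and>
         homotopic_with (\<lambda>_. True) X X (q \<circ> p) id \<and>
         homotopic_with (\<lambda>_. True) Y Y (p \<circ> q) id)"

text \<open>An explicit homotopy \<open>X \<times> [0,1] \<rightarrow> Y\<close>. As maps are total functions
  on the carrier types, equations between them are only required on the spaces themselves.\<close>

definition homotopy_from_to ::
    "'a topology \<Rightarrow> 'b topology \<Rightarrow> ('a \<times> real \<Rightarrow> 'b) \<Rightarrow> ('a \<Rightarrow> 'b) \<Rightarrow> ('a \<Rightarrow> 'b) \<Rightarrow> bool"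
  where "homotopy_from_to X Y h u v \<longleftrightarrow>
    continuous_map (prod_topology X unit_interval) Y h \<and>
    (\<forall>x\<in>topspace X. h (x, 0) = u x) \<and>
    (\<forall>x\<in>topspace X. h (x, 1) = v x)"

definition has_HEP :: "'a topology \<Rightarrow> 'b topology \<Rightarrow> ('a \<Rightarrow> 'b) \<Rightarrow> 'z topology \<Rightarrow> bool"
  where "has_HEP A B i Z \<longleftrightarrow>
    (\<forall>f h. continuous_map B Z f \<and>
           continuous_map (prod_topology A unit_interval) Z h \<and>
           (\<forall>a\<in>topspace A. h (a, 0) = f (i a)) \<longrightarrow>
       (\<exists>k. continuous_map (prod_topology B unit_interval) Z k \<and>
            (\<forall>b\<in>topspace B. k (b, 0) = f b) \<and>
            (\<forall>a\<in>topspace A. \<forall>t\<in>{0..1}. k (i a, t) = h (a, t))))"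

text \<open>A Hurewicz cofibration has the homotopy extension property for all spaces. A definition in HOL
  cannot quantify over types, so \<open>Z\<close> ranges over all topologies on one type, chosen
  large enough to carry the mapping cylinder of \<open>i\<close>; the lemma
  \<open>hurewicz_cofibration_has_HEP\<close> below shows that the property then holds for
  target spaces over every type, so that nothing depends on this choice.\<close>

definition hurewicz_cofibration :: "'a topology \<Rightarrow> 'b topology \<Rightarrow> ('a \<Rightarrow> 'b) \<Rightarrow> bool"
  where "hurewicz_cofibration A B i \<longleftrightarrow>
    continuous_map A B i \<and> (\<forall>Z :: ('a \<times> real + 'b) topology. has_HEP A B i Z)"

definition closed_cofibration :: "'a topology \<Rightarrow> 'b topology \<Rightarrow> ('a \<Rightarrow> 'b) \<Rightarrow> bool"
  where "closed_cofibration A B i \<longleftrightarrow>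
    hurewicz_cofibration A B i \<and> embedding_map A B i \<and> closed_map A B i"

definition has_HELP ::
    "'x topology \<Rightarrow> 'y topology \<Rightarrow> ('x \<Rightarrow> 'y) \<Rightarrow> 'a topology \<Rightarrow> 'b topology \<Rightarrow> ('a \<Rightarrow> 'b) \<Rightarrow> bool"
  where "has_HELP X Y p A B i \<longleftrightarrow>
    (\<forall>fA g hA. continuous_map A X fA \<and> continuous_map B Y g \<and>
               homotopy_from_to A Y hA (p \<circ> fA) (g \<circ> i) \<longrightarrow>
       (\<exists>f h. continuous_map B X f \<and> homotopy_from_to B Y h (p \<circ> f) g \<and>
              (\<forall>a\<in>topspace A. f (i a) = fA a) \<and>
              (\<forall>a\<in>topspace A. \<forall>t\<in>{0..1}. h (i a, t) = hA (a, t))))"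

text \<open>"HELP for all closed cofibrations" also quantifies over spaces of every carrier type. As a
  conclusion it is stated with type variables for the carriers of \<open>A\<close> and \<open>B\<close>. As a
  hypothesis it is stated for one carrier type, \<open>'x \<times> real + 'y\<close>, which carries copies of
  \<open>X \<times> [0,1]\<close>, \<open>Y\<close> and the mapping cylinder of \<open>p\<close>; this assumes no more than HELP for
  spaces over all types.\<close>

lemma hurewicz_cofibration_has_HEP:
  fixes A :: "'a topology" and B :: "'b topology" and Z :: "'z topology"
  assumes cof: "hurewicz_cofibration A B i"
  shows "has_HEP A B i Z"
  unfolding has_HEP_def
proof (intro allI impI, elim conjE)
  fix f h
  assume f: "continuous_map B Z f"
    and h: "continuous_map (prod_topology A unit_interval) Z h"
    and hf: "\<forall>a\<in>topspace A. h (a, 0) = f (i a)"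
  let ?AI = "prod_topology A unit_interval"
  define j :: "'a \<times> real \<Rightarrow> 'a \<times> real + 'b"
    where "j = (\<lambda>x. if snd x = 0 then Inr (i (fst x)) else Inl x)"
  have i: "continuous_map A B i"
    using cof by (simp add: hurewicz_cofibration_def)
  define S where "S = j ` topspace ?AI \<union> Inr ` topspace B"
  define P where "P = (\<lambda>U. U \<subseteq> S \<and> openin ?AI {x\<in>topspace ?AI. j x \<in> U} \<and>
                            openin B {b\<in>topspace B. Inr b \<in> U})"
  have "istopology P"
    unfolding istopology_def
  proof (intro conjI allI impI)
    fix U V assume U: "P U" and V: "P V"
    have "{x\<in>topspace ?AI. j x \<in> U \<inter> V} = {x\<in>topspace ?AI. j x \<in> U} \<inter> {x\<in>topspace ?AI. j x \<in> V}"
      and "{b\<in>topspace B. Inr b \<in> U \<inter> V} = {b\<in>topspace B. Inr b \<in> U} \<inter> {b\<in>topspace B. Inr b \<in> V}"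
      by auto
    moreover have "U \<inter> V \<subseteq> S"
      using U by (auto simp: P_def)
    ultimately show "P (U \<inter> V)"
      using U V unfolding P_def by (metis (no_types, lifting) openin_Int)
  next
    fix K assume K: "\<forall>U\<in>K. P U"
    have "{x\<in>topspace ?AI. j x \<in> \<Union>K} = (\<Union>U\<in>K. {x\<in>topspace ?AI. j x \<in> U})"
      and "{b\<in>topspace B. Inr b \<in> \<Union>K} = (\<Union>U\<in>K. {b\<in>topspace B. Inr b \<in> U})"
      by auto
    moreover have "openin ?AI (\<Union>U\<in>K. {x\<in>topspace ?AI. j x \<in> U})"
      by (rule openin_Union) (use K in \<open>auto simp: P_def\<close>)
    moreover have "openin B (\<Union>U\<in>K. {b\<in>topspace B. Inr b \<in> U})"
      by (rule openin_Union) (use K in \<open>auto simp: P_def\<close>)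
    moreover have "\<Union>K \<subseteq> S"
      using K by (auto simp: P_def)
    ultimately show "P (\<Union>K)"
      unfolding P_def by presburger
  qed
  define M where "M = topology P"
  have openM: "openin M U \<longleftrightarrow> P U" for U
    using \<open>istopology P\<close> by (simp add: M_def topology_inverse')
  have jS: "j x \<in> S" if "x \<in> topspace ?AI" for x
    using that by (auto simp: S_def)
  have rS: "Inr b \<in> S" if "b \<in> topspace B" for b
    using that by (auto simp: S_def)
  have "{x\<in>topspace ?AI. j x \<in> S} = topspace ?AI" "{b\<in>topspace B. Inr b \<in> S} = topspace B"
    using jS rS by auto
  then have "P S"
    unfolding P_def by (metis openin_topspace subset_refl)
  then have topM: "topspace M = S"
    by (metis P_def openM openin_subset openin_topspace subset_antisym)
  have cj: "continuous_map ?AI M j"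
    unfolding continuous_map_def using jS topM openM by (auto simp: P_def Pi_iff)
  have cr: "continuous_map B M Inr"
    unfolding continuous_map_def using rS topM openM by (auto simp: P_def Pi_iff)
  have "has_HEP A B i M"
    using cof by (simp add: hurewicz_cofibration_def)
  moreover have "\<forall>a\<in>topspace A. j (a, 0) = Inr (i a)"
    by (simp add: j_def)
  ultimately obtain k where k: "continuous_map (prod_topology B unit_interval) M k"
    and k0: "\<forall>b\<in>topspace B. k (b, 0) = Inr b"
    and kj: "\<forall>a\<in>topspace A. \<forall>t\<in>{0..1}. k (i a, t) = j (a, t)"
    using cj cr unfolding has_HEP_def by blast
  define \<phi> where "\<phi> = case_sum h f"
  have \<phi>r: "\<phi> (Inr b) = f b" for b
    by (simp add: \<phi>_def)
  have \<phi>j: "\<phi> (j x) = h x" if "x \<in> topspace ?AI" for x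
    using that hf by (cases x) (auto simp: \<phi>_def j_def)
  have "continuous_map M Z \<phi>"
    unfolding continuous_map_def
  proof (intro conjI allI impI)
    show "\<phi> \<in> topspace M \<rightarrow> topspace Z"
    proof
      fix s assume "s \<in> topspace M"
      then consider x where "x \<in> topspace ?AI" "s = j x" | b where "b \<in> topspace B" "s = Inr b"
        unfolding topM S_def by blast
      then show "\<phi> s \<in> topspace Z"
      proof cases
        case 1
        then show ?thesis
          using \<phi>j h by (metis continuous_map_image_subset_topspace image_subset_iff)
      next
        case 2
        then show ?thesis
          using \<phi>r f by (metis continuous_map_image_subset_topspace image_subset_iff)
      qed
    qed
  next
    fix U assume U: "openin Z U"
    have "{x\<in>topspace ?AI. j x \<in> {s\<in>topspace M. \<phi> s \<in> U}} = {x\<in>topspace ?AI. h x \<in> U}"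
      using jS \<phi>j topM by auto
    moreover have "{b\<in>topspace B. Inr b \<in> {s\<in>topspace M. \<phi> s \<in> U}} = {b\<in>topspace B. f b \<in> U}"
      using rS \<phi>r topM by auto
    moreover have "openin ?AI {x\<in>topspace ?AI. h x \<in> U}" "openin B {b\<in>topspace B. f b \<in> U}"
      using U h f openin_continuous_map_preimage by blast+
    moreover have "{s\<in>topspace M. \<phi> s \<in> U} \<subseteq> S"
      using topM by auto
    ultimately show "openin M {s\<in>topspace M. \<phi> s \<in> U}"
      unfolding openM P_def by presburger
  qed
  then have "continuous_map (prod_topology B unit_interval) Z (\<phi> \<circ> k)"
    using k continuous_map_compose by blast
  moreover have "\<forall>b\<in>topspace B. (\<phi> \<circ> k) (b, 0) = f b"
    using k0 \<phi>r by simp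
  moreover have "\<forall>a\<in>topspace A. \<forall>t\<in>{0..1}. (\<phi> \<circ> k) (i a, t) = h (a, t)"
    using kj \<phi>j by simp
  ultimately show "\<exists>k. continuous_map (prod_topology B unit_interval) Z k \<and>
            (\<forall>b\<in>topspace B. k (b, 0) = f b) \<and>
            (\<forall>a\<in>topspace A. \<forall>t\<in>{0..1}. k (i a, t) = h (a, t))"
    by blast
qed

end

theory Submission
  imports Defs "HOL-Analysis.Abstract_Limits"
begin

text \<open>Suppose first that \<open>p\<close> has a homotopy inverse. It is easy to solve a HELP
  problem up to a defect: the homotopy on \<open>B\<close> has the right ends, but over
  \<open>A\<close> it differs from \<open>hA\<close> by a detour or by a correction homotopy. The
  defect can be removed with the ends fixed, because over \<open>A\<close> the homotopy moves
  through a family \<open>M\<close> with a real parameter, so that only the parameter has to be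
  changed from some \<open>\<alpha>\<close> to some \<open>\<beta>\<close>. Along a closed
  cofibration such a change extends to \<open>B\<close> and can be kept trivial at all times where
  \<open>\<alpha>\<close> and \<open>\<beta>\<close> agree
  (\<open>closed_cofibration_reparametrize\<close>), since
  \<open>A \<times> T \<rightarrow> B \<times> T\<close> inherits the homotopy extension property
  (\<open>closed_cofibration_times_HEP\<close>).

  This gives HELP for a self-map homotopic to the identity (\<open>has_HELP_homotopic_id\<close>).
  For general \<open>p\<close> with inverse \<open>q\<close>, the problem is mapped by
  \<open>q\<close> to one for \<open>q \<circ> p\<close>, solved there, mapped back by
  \<open>p\<close>, and corrected by the homotopy from \<open>p \<circ> q\<close> to the identity
  (\<open>homotopy_equivalence_imp_has_HELP\<close>).

  Conversely, two test cofibrations suffice: the empty space in \<open>Y\<close> gives a right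
  homotopy inverse \<open>q\<close>, and the two ends of the cylinder on \<open>X\<close> give a
  homotopy from \<open>q \<circ> p\<close> to the identity
  (\<open>has_HELP_imp_homotopy_equivalence\<close>). Both are copied along injections into the one
  carrier type for which HELP is assumed (\<open>has_HELP_of_larger_carrier\<close>).\<close>

section \<open>Clamped homotopy times and gluing of maps\<close>

definition unit_clamp :: "real \<Rightarrow> real"
  where "unit_clamp t = max 0 (min 1 t)"

lemma unit_clamp_simps:
  "t \<le> 0 \<Longrightarrow> unit_clamp t = 0"
  "1 \<le> t \<Longrightarrow> unit_clamp t = 1"
  "0 \<le> t \<Longrightarrow> t \<le> 1 \<Longrightarrow> unit_clamp t = t"
  by (auto simp: unit_clamp_def)

lemma unit_clamp_bounds: "0 \<le> unit_clamp t" "unit_clamp t \<le> 1"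
  by (auto simp: unit_clamp_def)

lemma continuous_map_compose_lambda:
  "continuous_map Y Z g \<Longrightarrow> continuous_map X Y f \<Longrightarrow> continuous_map X Z (\<lambda>x. g (f x))"
  using continuous_map_compose[of X Y f Z g] by (simp add: o_def)

text \<open>Extending a homotopy constantly beyond 0 and 1 allows any real function as its time, so
  every branch of a piecewise formula is continuous on the whole space.\<close>

lemma continuous_map_homotopy_clamp:
  assumes "continuous_map (prod_topology S unit_interval) Z h"
    and "continuous_map W S u" and "continuous_map W euclideanreal v"
  shows "continuous_map W Z (\<lambda>w. h (u w, unit_clamp (v w)))"
proof -
  have "continuous_map W unit_interval (\<lambda>w. unit_clamp (v w))"
    unfolding continuous_map_in_subtopology
    by (auto simp: unit_clamp_def intro!: continuous_map_real_max continuous_map_real_min assms)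
  then have "continuous_map W (prod_topology S unit_interval) (\<lambda>w. (u w, unit_clamp (v w)))"
    using assms(2) by (simp add: continuous_map_paired)
  then show ?thesis
    by (rule continuous_map_compose_lambda[OF assms(1)])
qed

lemma continuous_map_if_closed:
  assumes "closedin X S" "closedin X T" "topspace X \<subseteq> S \<union> T"
    and "continuous_map (subtopology X S) Y f" "continuous_map (subtopology X T) Y g"
    and "\<And>x. x \<in> S \<inter> T \<Longrightarrow> f x = g x"
  shows "continuous_map X Y (\<lambda>x. if x \<in> S then f x else g x)"
proof (rule pasting_lemma_closed[where I = UNIV and T = "\<lambda>b. if b then S else T"
      and f = "\<lambda>b. if b then f else g"])
  fix x assume "x \<in> topspace X"
  then show "\<exists>j. j \<in> UNIV \<and> x \<in> (if j then S else T) \<and>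
      (if x \<in> S then f x else g x) = (if j then f else g) x"
    using assms(3) by (cases "x \<in> S") (auto intro: exI[of _ True] exI[of _ False])
qed (use assms in \<open>auto split: if_splits\<close>)

lemma continuous_map_if_le:
  assumes "continuous_map W euclideanreal v"
    and "continuous_map W Z f" "continuous_map W Z g"
    and "\<And>x. x \<in> topspace W \<Longrightarrow> v x = c \<Longrightarrow> f x = g x"
  shows "continuous_map W Z (\<lambda>x. if v x \<le> c then f x else g x)"
  by (rule continuous_map_cases_le)
    (use assms in \<open>auto intro: continuous_map_from_subtopology\<close>)

section \<open>Extension properties of closed cofibrations\<close>

lemma has_HEPD:
  assumes "has_HEP A B i Z" "continuous_map B Z f"
    and "continuous_map (prod_topology A unit_interval) Z h"
    and "\<And>a. a \<in> topspace A \<Longrightarrow> h (a, 0) = f (i a)"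
  obtains k where "continuous_map (prod_topology B unit_interval) Z k"
    and "\<And>b. b \<in> topspace B \<Longrightarrow> k (b, 0) = f b"
    and "\<And>a t. a \<in> topspace A \<Longrightarrow> 0 \<le> t \<Longrightarrow> t \<le> 1 \<Longrightarrow> k (i a, t) = h (a, t)"
proof -
  have "\<forall>a\<in>topspace A. h (a, 0) = f (i a)"
    using assms(4) by blast
  then have "\<exists>k. continuous_map (prod_topology B unit_interval) Z k \<and>
      (\<forall>b\<in>topspace B. k (b, 0) = f b) \<and> (\<forall>a\<in>topspace A. \<forall>t\<in>{0..1}. k (i a, t) = h (a, t))"
    using assms(1)[unfolded has_HEP_def, THEN spec, THEN spec, of f h] assms(2,3)
    by (elim mp) (intro conjI)
  then show thesis
    by (elim exE conjE) (rule that, auto)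
qed

lemma has_HELPD:
  assumes "has_HELP X Y p A B i" "continuous_map A X fA" "continuous_map B Y g"
    and "homotopy_from_to A Y hA (p \<circ> fA) (g \<circ> i)"
  obtains f h where "continuous_map B X f" and "homotopy_from_to B Y h (p \<circ> f) g"
    and "\<And>a. a \<in> topspace A \<Longrightarrow> f (i a) = fA a"
    and "\<And>a t. a \<in> topspace A \<Longrightarrow> t \<in> {0..1} \<Longrightarrow> h (i a, t) = hA (a, t)"
proof -
  have "\<exists>f h. continuous_map B X f \<and> homotopy_from_to B Y h (p \<circ> f) g \<and>
      (\<forall>a\<in>topspace A. f (i a) = fA a) \<and> (\<forall>a\<in>topspace A. \<forall>t\<in>{0..1}. h (i a, t) = hA (a, t))"
    using assms(1)[unfolded has_HELP_def, THEN spec, THEN spec, THEN spec, of fA g hA] assms(2-4)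
    by (elim mp) (intro conjI)
  then obtain f h where fh: "continuous_map B X f" "homotopy_from_to B Y h (p \<circ> f) g"
    "\<forall>a\<in>topspace A. f (i a) = fA a" "\<forall>a\<in>topspace A. \<forall>t\<in>{0..1}. h (i a, t) = hA (a, t)"
    by (elim exE conjE)
  show thesis
    by (rule that[OF fh(1,2) bspec[OF fh(3)] bspec[OF bspec[OF fh(4)]]])
qed

lemma closed_cofibration_imp_continuous_map:
  "closed_cofibration A B i \<Longrightarrow> continuous_map A B i"
  by (simp add: closed_cofibration_def hurewicz_cofibration_def)

text \<open>The target may live over any type; below it is, among others, a subspace of
  \<open>B \<times> [0,1]\<close> and the space \<open>X\<close>.\<close>

lemma closed_cofibration_imp_HEP:
  fixes A :: "'a topology" and B :: "'b topology" and Z :: "'z topology"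
  shows "closed_cofibration A B i \<Longrightarrow> has_HEP A B i Z"
  by (simp add: closed_cofibration_def hurewicz_cofibration_has_HEP)

text \<open>The universal case of the homotopy extension property is the retraction
  \<open>r : B \<times> [0,1] \<rightarrow> i(A) \<times> [0,1] \<union> B \<times> {0}\<close>; it survives multiplication with \<open>T\<close>, and closedness of
  \<open>i(A)\<close> allows maps on its image to be glued.\<close>

lemma closed_cofibration_times_HEP:
  fixes A :: "'a topology" and B :: "'b topology" and T :: "'t topology" and Z :: "'z topology"
  assumes "closed_cofibration A B i"
  shows "has_HEP (prod_topology A T) (prod_topology B T) (map_prod i id) Z"
  unfolding has_HEP_def
proof (intro allI impI, elim conjE)
  fix F H
  assume F: "continuous_map (prod_topology B T) Z F"
    and H: "continuous_map (prod_topology (prod_topology A T) unit_interval) Z H"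
    and HF: "\<forall>a\<in>topspace (prod_topology A T). H (a, 0) = F (map_prod i id a)"
  define C where "C = i ` topspace A"
  have i: "continuous_map A B i"
    by (rule closed_cofibration_imp_continuous_map[OF assms])
  have "embedding_map A B i" and "closed_map A B i"
    using assms by (auto simp: closed_cofibration_def)
  then have C: "closedin B C"
    by (auto simp: C_def closed_map_def)
  from \<open>embedding_map A B i\<close> obtain i' where i': "homeomorphic_maps A (subtopology B C) i i'"
    by (auto simp: embedding_map_def homeomorphic_map_maps C_def)
  then have ci': "continuous_map (subtopology B C) A i'" and i'i: "\<And>a. a \<in> topspace A \<Longrightarrow> i' (i a) = a"
    by (auto simp: homeomorphic_maps_def)
  define D where "D = C \<times> {0..1} \<union> topspace B \<times> {0::real}"
  let ?R = "subtopology (prod_topology B unit_interval) D"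
  have f: "continuous_map B ?R (\<lambda>b. (b, 0))"
    by (auto simp: continuous_map_in_subtopology continuous_map_paired D_def)
  have h: "continuous_map (prod_topology A unit_interval) ?R (map_prod i id)"
    unfolding continuous_map_in_subtopology
    using i by (auto simp: map_prod_def continuous_map_prod_top D_def C_def)
  obtain r where r: "continuous_map (prod_topology B unit_interval) ?R r"
    and r0: "\<And>b. b \<in> topspace B \<Longrightarrow> r (b, 0) = (b, 0)"
    and ri: "\<And>a t. a \<in> topspace A \<Longrightarrow> 0 \<le> t \<Longrightarrow> t \<le> 1 \<Longrightarrow> r (i a, t) = map_prod i id (a, t)"
    by (rule has_HEPD[OF closed_cofibration_imp_HEP[OF assms] f h]) auto
  let ?W = "prod_topology ?R T"
  let ?S = "{x \<in> topspace ?W. fst (fst x) \<in> C}"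
  let ?S' = "{x \<in> topspace ?W. snd (fst x) \<in> {0}}"
  have 1: "continuous_map ?W (prod_topology B unit_interval) fst"
    by (rule continuous_map_into_fulltopology[OF continuous_map_fst])
  have 2: "continuous_map ?W B (\<lambda>x. fst (fst x))" "continuous_map ?W unit_interval (\<lambda>x. snd (fst x))"
    by (rule continuous_map_compose_lambda[OF continuous_map_fst 1]
        continuous_map_compose_lambda[OF continuous_map_snd 1])+
  \<comment> \<open>\<open>F\<close> and \<open>H\<close> together form one map on
    \<open>?R \<times> T\<close>. Composed with \<open>r\<close> times the identity of
    \<open>T\<close>, it becomes the extension \<open>k\<close>.\<close>
  define G where "G = (\<lambda>x. if x \<in> ?S then H ((i' (fst (fst x)), snd x), snd (fst x))
      else F (fst (fst x), snd x))"
  have "continuous_map ?W Z G"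
    unfolding G_def
  proof (rule continuous_map_if_closed)
    show "closedin ?W ?S" "closedin ?W ?S'"
      by (rule closedin_continuous_map_preimage[OF 2(1) C]
          closedin_continuous_map_preimage[OF continuous_map_into_fulltopology[OF 2(2)]]; simp)+
    show "topspace ?W \<subseteq> ?S \<union> ?S'"
      by (auto simp: D_def)
    have "continuous_map (subtopology ?W ?S) (subtopology B C) (\<lambda>x. fst (fst x))"
      using 2(1) by (auto simp: continuous_map_in_subtopology intro: continuous_map_from_subtopology)
    then have "continuous_map (subtopology ?W ?S) A (\<lambda>x. i' (fst (fst x)))"
      by (rule continuous_map_compose_lambda[OF ci'])
    then have "continuous_map (subtopology ?W ?S) (prod_topology (prod_topology A T) unit_interval)
        (\<lambda>x. ((i' (fst (fst x)), snd x), snd (fst x)))"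
      using 2(2) by (simp add: continuous_map_paired continuous_map_from_subtopology continuous_map_snd)
    then show "continuous_map (subtopology ?W ?S) Z (\<lambda>x. H ((i' (fst (fst x)), snd x), snd (fst x)))"
      by (rule continuous_map_compose_lambda[OF H])
    have "continuous_map (subtopology ?W ?S') (prod_topology B T) (\<lambda>x. (fst (fst x), snd x))"
      using 2(1) by (simp add: continuous_map_paired continuous_map_from_subtopology continuous_map_snd)
    then show "continuous_map (subtopology ?W ?S') Z (\<lambda>x. F (fst (fst x), snd x))"
      by (rule continuous_map_compose_lambda[OF F])
    show "H ((i' (fst (fst x)), snd x), snd (fst x)) = F (fst (fst x), snd x)" if "x \<in> ?S \<inter> ?S'" for x
      using that HF i'i by (auto simp: C_def)
  qed
  define k where "k = (\<lambda>x. G (r (fst (fst x), snd x), snd (fst x)))"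
  have "continuous_map (prod_topology (prod_topology B T) unit_interval) (prod_topology B unit_interval)
      (\<lambda>x. (fst (fst x), snd x))"
    by (intro continuous_map_pairedI continuous_map_snd
        continuous_map_compose_lambda[OF continuous_map_fst continuous_map_fst])
  then have "continuous_map (prod_topology (prod_topology B T) unit_interval) ?R
      (\<lambda>x. r (fst (fst x), snd x))"
    by (rule continuous_map_compose_lambda[OF r])
  then have "continuous_map (prod_topology (prod_topology B T) unit_interval) ?W
      (\<lambda>x. (r (fst (fst x), snd x), snd (fst x)))"
    by (intro continuous_map_pairedI
        continuous_map_compose_lambda[OF continuous_map_snd continuous_map_fst])
  then have "continuous_map (prod_topology (prod_topology B T) unit_interval) Z k"
    unfolding k_def by (rule continuous_map_compose_lambda[OF \<open>continuous_map ?W Z G\<close>])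
  moreover have "\<forall>b\<in>topspace (prod_topology B T). k (b, 0) = F b"
    using r0 HF i'i by (auto simp: k_def G_def C_def)
  moreover have "\<forall>a\<in>topspace (prod_topology A T). \<forall>t\<in>{0..1}. k (map_prod i id a, t) = H (a, t)"
    using ri i'i i by (auto simp: k_def G_def C_def D_def continuous_map_def)
  ultimately show "\<exists>k. continuous_map (prod_topology (prod_topology B T) unit_interval) Z k \<and>
      (\<forall>b\<in>topspace (prod_topology B T). k (b, 0) = F b) \<and>
      (\<forall>a\<in>topspace (prod_topology A T). \<forall>t\<in>{0..1}. k (map_prod i id a, t) = H (a, t))"
    by blast
qed

text \<open>The homotopy \<open>\<gamma>\<close> moves from \<open>\<alpha>\<close> towards \<open>\<beta>\<close> with speed \<open>c\<close> and stops there. Evaluating at the time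
  \<open>\<bar>\<beta> - \<alpha>\<bar> / c\<close>, which is 0 where \<open>\<alpha>\<close> and \<open>\<beta>\<close> agree, leaves \<open>P\<close> unchanged at these places.\<close>

lemma closed_cofibration_reparametrize:
  fixes A :: "'a topology" and B :: "'b topology" and T :: "'t topology" and Z :: "'z topology"
    and \<alpha> \<beta> :: "'t \<Rightarrow> real"
  assumes cof: "closed_cofibration A B i"
    and M: "continuous_map (prod_topology (prod_topology A T) euclideanreal) Z M"
    and P: "continuous_map (prod_topology B T) Z P"
    and \<alpha>: "continuous_map T euclideanreal \<alpha>" and \<beta>: "continuous_map T euclideanreal \<beta>"
    and c: "c > 0" "\<And>t. t \<in> topspace T \<Longrightarrow> \<bar>\<beta> t - \<alpha> t\<bar> \<le> c"
    and PM: "\<And>a t. a \<in> topspace A \<Longrightarrow> t \<in> topspace T \<Longrightarrow> P (i a, t) = M ((a, t), \<alpha> t)"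
  obtains h where "continuous_map (prod_topology B T) Z h"
    and "\<And>a t. a \<in> topspace A \<Longrightarrow> t \<in> topspace T \<Longrightarrow> h (i a, t) = M ((a, t), \<beta> t)"
    and "\<And>b t. b \<in> topspace B \<Longrightarrow> t \<in> topspace T \<Longrightarrow> \<alpha> t = \<beta> t \<Longrightarrow> h (b, t) = P (b, t)"
proof -
  \<comment> \<open>\<open>\<gamma> t u\<close> is \<open>\<beta> t\<close> clamped to the interval
    of radius \<open>c * u\<close> about \<open>\<alpha> t\<close>. The bound on the distance of
    \<open>\<alpha>\<close> and \<open>\<beta>\<close> ensures arrival within [0,1].\<close>
  define \<gamma> where "\<gamma> t u = max (\<alpha> t - c * u) (min (\<alpha> t + c * u) (\<beta> t))" for t u
  let ?AT = "prod_topology A T" and ?BT = "prod_topology B T"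
  have snd_AT: "continuous_map (prod_topology ?AT unit_interval) T (\<lambda>x. snd (fst x))"
    by (rule continuous_map_compose_lambda[OF continuous_map_snd continuous_map_fst])
  have ab: "continuous_map (prod_topology ?AT unit_interval) euclideanreal (\<lambda>x. \<alpha> (snd (fst x)))"
    "continuous_map (prod_topology ?AT unit_interval) euclideanreal (\<lambda>x. \<beta> (snd (fst x)))"
    using continuous_map_compose[OF snd_AT \<alpha>] continuous_map_compose[OF snd_AT \<beta>] by (simp_all add: o_def)
  have u: "continuous_map (prod_topology ?AT unit_interval) euclideanreal (\<lambda>x. c * snd x)"
    by (intro continuous_map_real_mult_left continuous_map_into_fulltopology[OF continuous_map_snd])
  have "continuous_map (prod_topology ?AT unit_interval) euclideanreal (\<lambda>x. \<gamma> (snd (fst x)) (snd x))"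
    unfolding \<gamma>_def
    by (intro continuous_map_real_max continuous_map_real_min continuous_map_add continuous_map_diff ab u)
  then have "continuous_map (prod_topology ?AT unit_interval) (prod_topology ?AT euclideanreal)
      (\<lambda>x. (fst x, \<gamma> (snd (fst x)) (snd x)))"
    by (intro continuous_intros)
  then have H: "continuous_map (prod_topology ?AT unit_interval) Z (\<lambda>x. M (fst x, \<gamma> (snd (fst x)) (snd x)))"
    by (rule continuous_map_compose_lambda[OF M])
  have "M (fst (x, 0), \<gamma> (snd (fst (x, 0))) (snd (x, 0))) = P (map_prod i id x)" if "x \<in> topspace ?AT" for x
    using that PM by (auto simp: \<gamma>_def)
  then obtain K where K: "continuous_map (prod_topology ?BT unit_interval) Z K"
    and K0: "\<And>x. x \<in> topspace ?BT \<Longrightarrow> K (x, 0) = P x"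
    and Ki: "\<And>x u. x \<in> topspace ?AT \<Longrightarrow> 0 \<le> u \<Longrightarrow> u \<le> 1 \<Longrightarrow> K (map_prod i id x, u) = M (x, \<gamma> (snd x) u)"
    using has_HEPD[OF closed_cofibration_times_HEP[OF cof] P H] by auto
  define \<phi> where "\<phi> t = \<bar>\<beta> t - \<alpha> t\<bar> / c" for t
  have "continuous_map T euclideanreal \<phi>"
    unfolding \<phi>_def using c(1) by (intro continuous_map_real_divide continuous_map_real_abs continuous_map_diff \<alpha> \<beta>) auto
  moreover have "\<phi> t \<in> {0..1}" if "t \<in> topspace T" for t
    using c(1) c(2)[OF that] by (auto simp: \<phi>_def)
  ultimately have "continuous_map T unit_interval \<phi>"
    by (auto simp: continuous_map_in_subtopology)
  then have "continuous_map ?BT unit_interval (\<lambda>x. \<phi> (snd x))"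
    by (rule continuous_map_compose_lambda[OF _ continuous_map_snd])
  then have "continuous_map ?BT (prod_topology ?BT unit_interval) (\<lambda>x. (x, \<phi> (snd x)))"
    by (intro continuous_map_pairedI continuous_map_id[unfolded id_def])
  then have "continuous_map ?BT Z (\<lambda>x. K (x, \<phi> (snd x)))"
    by (rule continuous_map_compose_lambda[OF K])
  moreover have "K ((i a, t), \<phi> (snd (i a, t))) = M ((a, t), \<beta> t)" if "a \<in> topspace A" "t \<in> topspace T" for a t
  proof -
    have "\<gamma> t (\<phi> t) = \<beta> t"
      using c(1) by (auto simp: \<gamma>_def \<phi>_def)
    then show ?thesis
      using that Ki[of "(a, t)" "\<phi> t"] \<open>\<And>t. t \<in> topspace T \<Longrightarrow> \<phi> t \<in> {0..1}\<close> by auto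
  qed
  moreover have "K ((b, t), \<phi> (snd (b, t))) = P (b, t)"
    if "b \<in> topspace B" "t \<in> topspace T" "\<alpha> t = \<beta> t" for b t
    using that K0 by (simp add: \<phi>_def)
  ultimately show thesis
    using that by blast
qed


section \<open>Homotopy equivalences have HELP\<close>

lemma homotopy_from_toD:
  assumes "homotopy_from_to X Y h u v"
  shows "continuous_map (prod_topology X unit_interval) Y h"
    and "x \<in> topspace X \<Longrightarrow> h (x, 0) = u x"
    and "x \<in> topspace X \<Longrightarrow> h (x, 1) = v x"
  using assms by (auto simp: homotopy_from_to_def)

lemma homotopic_with_iff_homotopy_from_to:
  "homotopic_with (\<lambda>_. True) X Y u v \<longleftrightarrow> (\<exists>h. homotopy_from_to X Y h u v)"
proof
  assume "homotopic_with (\<lambda>_. True) X Y u v"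
  then obtain h where h: "continuous_map (prod_topology unit_interval X) Y h"
    and "\<forall>x. h (0, x) = u x" "\<forall>x. h (1, x) = v x"
    by (auto simp: homotopic_with_def)
  moreover have "continuous_map (prod_topology X unit_interval) Y (\<lambda>x. h (snd x, fst x))"
    by (rule continuous_map_compose_lambda[OF h]) (intro continuous_intros)
  ultimately show "\<exists>h. homotopy_from_to X Y h u v"
    by (intro exI[of _ "\<lambda>x. h (snd x, fst x)"]) (simp add: homotopy_from_to_def)
next
  assume "\<exists>h. homotopy_from_to X Y h u v"
  then obtain h where h: "homotopy_from_to X Y h u v" ..
  have "continuous_map (prod_topology unit_interval X) Y (\<lambda>x. h (snd x, fst x))"
    by (rule continuous_map_compose_lambda[OF homotopy_from_toD(1)[OF h]]) (intro continuous_intros)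
  then show "homotopic_with (\<lambda>_. True) X Y u v"
    using homotopy_from_toD[OF h]
    by (subst homotopic_with) (auto intro!: exI[of _ "\<lambda>x. h (snd x, fst x)"])
qed

text \<open>On \<open>A\<close>, the inverse of \<open>hA\<close> followed by \<open>E \<circ> fA\<close> runs from \<open>g \<circ> i\<close> to \<open>fA\<close>. Its extension \<open>G\<close>
  to \<open>B\<close> runs from \<open>g\<close> to some \<open>f\<close>, and \<open>E \<circ> f\<close> followed by the inverse of \<open>G\<close> restricts on \<open>A\<close> to \<open>hA\<close>
  up to the detour \<open>\<alpha>\<close> along \<open>E \<circ> fA\<close> and back.\<close>

lemma has_HELP_homotopic_id:
  fixes A :: "'a topology" and B :: "'b topology" and X :: "'x topology"
  assumes cof: "closed_cofibration A B i" and E: "homotopy_from_to X X E e id"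
  shows "has_HELP X X e A B i"
  unfolding has_HELP_def
proof (intro allI impI, elim conjE)
  fix fA g hA
  assume fA: "continuous_map A X fA" and g: "continuous_map B X g"
    and hA: "homotopy_from_to A X hA (e \<circ> fA) (g \<circ> i)"
  note E' = homotopy_from_toD[OF E] and hA' = homotopy_from_toD[OF hA]
  have fAX: "fA a \<in> topspace X" if "a \<in> topspace A" for a
    using fA that by (auto simp: continuous_map_def)
  \<comment> \<open>Along the real line \<open>N\<close> is \<open>fA\<close> up to -1, follows
    \<open>E\<close> backwards to \<open>e \<circ> fA\<close> at 0, then \<open>hA\<close> to
    \<open>g \<circ> i\<close> at 1, and stays there.\<close>
  define N where "N = (\<lambda>x. if snd x \<le> 0 then E (fA (fst x), unit_clamp (- snd x))
      else hA (fst x, unit_clamp (snd x)))"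
  have N: "continuous_map (prod_topology A euclideanreal) X N"
    unfolding N_def
  proof (rule continuous_map_if_le)
    show "continuous_map (prod_topology A euclideanreal) X (\<lambda>x. E (fA (fst x), unit_clamp (- snd x)))"
      by (intro continuous_map_homotopy_clamp[OF E'(1)] continuous_map_minus continuous_map_snd
          continuous_map_compose_lambda[OF fA] continuous_map_fst)
    show "continuous_map (prod_topology A euclideanreal) X (\<lambda>x. hA (fst x, unit_clamp (snd x)))"
      by (intro continuous_map_homotopy_clamp[OF hA'(1)] continuous_map_snd continuous_map_fst)
  qed (use E'(2) hA'(2) fAX in \<open>auto simp: unit_clamp_simps continuous_map_snd\<close>)
  have "continuous_map (prod_topology A unit_interval) (prod_topology A euclideanreal) (\<lambda>x. (fst x, 1 - 2 * snd x))"
    by (intro continuous_map_pairedI continuous_map_fst continuous_map_diff continuous_map_real_mult_left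
        continuous_map_into_fulltopology[OF continuous_map_snd]) auto
  from continuous_map_compose_lambda[OF N this]
  have "continuous_map (prod_topology A unit_interval) X (\<lambda>x. N (fst x, 1 - 2 * snd x))" .
  then obtain G where G: "continuous_map (prod_topology B unit_interval) X G"
    and G0: "\<And>b. b \<in> topspace B \<Longrightarrow> G (b, 0) = g b"
    and Gi: "\<And>a u. a \<in> topspace A \<Longrightarrow> 0 \<le> u \<Longrightarrow> u \<le> 1 \<Longrightarrow> G (i a, u) = N (fst (a, u), 1 - 2 * snd (a, u))"
    by (rule has_HEPD[OF closed_cofibration_imp_HEP[OF cof] g])
      (use hA'(3) in \<open>auto simp: N_def unit_clamp_simps\<close>)
  define f where "f b = G (b, 1)" for b
  have f: "continuous_map B X f"
    unfolding f_def by (rule continuous_map_compose_lambda[OF G]) (simp add: continuous_map_paired)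
  have fi: "f (i a) = fA a" if "a \<in> topspace A" for a
    using that Gi E'(3) fAX by (simp add: f_def N_def unit_clamp_simps)
  have fX: "f b \<in> topspace X" if "b \<in> topspace B" for b
    using f that by (auto simp: continuous_map_def)
  let ?T = "top_of_set {-2..1::real}"
  \<comment> \<open>\<open>P\<close> follows \<open>E\<close> from \<open>e \<circ> f\<close> to
    \<open>f\<close> over [-2,-1], then \<open>G\<close> backwards from \<open>f\<close> to
    \<open>g\<close> over [-1,1].\<close>
  define P where "P = (\<lambda>x. if snd x \<le> -1 then E (f (fst x), unit_clamp (snd x + 2))
      else G (fst x, unit_clamp ((1 - snd x) * (1/2))))"
  have sT: "continuous_map (prod_topology B ?T) euclideanreal snd"
    by (rule continuous_map_into_fulltopology[OF continuous_map_snd])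
  have P: "continuous_map (prod_topology B ?T) X P"
    unfolding P_def
  proof (rule continuous_map_if_le)
    show "continuous_map (prod_topology B ?T) X (\<lambda>x. E (f (fst x), unit_clamp (snd x + 2)))"
      by (intro continuous_map_homotopy_clamp[OF E'(1)] continuous_map_add sT
          continuous_map_compose_lambda[OF f] continuous_map_fst) auto
    show "continuous_map (prod_topology B ?T) X (\<lambda>x. G (fst x, unit_clamp ((1 - snd x) * (1/2))))"
      by (intro continuous_map_homotopy_clamp[OF G] continuous_map_real_mult_right continuous_map_diff sT continuous_map_fst) auto
  qed (use sT fX E'(3) in \<open>auto simp: unit_clamp_simps f_def\<close>)
  have M: "continuous_map (prod_topology (prod_topology A ?T) euclideanreal) X (\<lambda>x. N (fst (fst x), snd x))"
    by (rule continuous_map_compose_lambda[OF N])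
      (intro continuous_map_pairedI continuous_map_snd continuous_map_compose_lambda[OF continuous_map_fst continuous_map_fst])
  \<comment> \<open>Over \<open>A\<close>, \<open>P\<close> is \<open>N\<close> at parameter
    \<open>\<alpha>\<close>, which goes from 0 down to -1 and then up to 1. The direct route
    \<open>\<beta>\<close> from 0 to 1 passes through \<open>hA\<close> only. Both agree at -2 and
    1, so the ends of \<open>P\<close> survive.\<close>
  define \<alpha> \<beta> where "\<alpha> t = \<bar>t + 1\<bar> - 1" and "\<beta> t = (t + 2) / 3" for t :: real
  have \<alpha>\<beta>: "continuous_map ?T euclideanreal \<alpha>" "continuous_map ?T euclideanreal \<beta>"
    by (auto simp: \<alpha>_def[abs_def] \<beta>_def[abs_def] intro!: continuous_intros)
  have bd: "\<bar>\<beta> t - \<alpha> t\<bar> \<le> 2" if "t \<in> topspace ?T" for t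
    using that by (auto simp: \<alpha>_def \<beta>_def abs_le_iff abs_if field_simps)
  have PM: "P (i a, t) = N (fst (fst ((a, t), \<alpha> t)), snd ((a, t), \<alpha> t))" if "a \<in> topspace A" "t \<in> topspace ?T" for a t
  proof (cases "t \<le> -1")
    case True
    then have "\<alpha> t = - t - 2"
      by (simp add: \<alpha>_def)
    then show ?thesis
      using True that fi by (simp add: P_def N_def add.commute)
  next
    case False
    then have "\<alpha> t = t" "unit_clamp ((1 - t) * (1/2)) = (1 - t) * (1/2)"
      using that by (auto simp: \<alpha>_def unit_clamp_simps)
    with False have "P (i a, t) = G (i a, (1 - t) * (1/2))"
      by (simp only: P_def fst_conv snd_conv if_False)
    also have "\<dots> = N (a, 1 - 2 * ((1 - t) * (1/2)))"
      using False that Gi[of a "(1 - t) * (1/2)"] by simp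
    finally show ?thesis
      using \<open>\<alpha> t = t\<close> by (simp add: field_simps)
  qed
  obtain h where h: "continuous_map (prod_topology B ?T) X h"
    and hi: "\<And>a t. a \<in> topspace A \<Longrightarrow> t \<in> topspace ?T \<Longrightarrow>
      h (i a, t) = N (fst (fst ((a, t), \<beta> t)), snd ((a, t), \<beta> t))"
    and hP: "\<And>b t. b \<in> topspace B \<Longrightarrow> t \<in> topspace ?T \<Longrightarrow> \<alpha> t = \<beta> t \<Longrightarrow> h (b, t) = P (b, t)"
    using closed_cofibration_reparametrize[OF cof M P \<alpha>\<beta> zero_less_numeral bd PM] by blast
  define k where "k = (\<lambda>x. h (fst x, 3 * snd x - 2))"
  have "continuous_map (prod_topology B unit_interval) ?T (\<lambda>x. 3 * snd x - 2)"
    by (auto simp: continuous_map_in_subtopology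
        intro!: continuous_map_diff continuous_map_real_mult_left continuous_map_into_fulltopology[OF continuous_map_snd])
  then have "continuous_map (prod_topology B unit_interval) X k"
    unfolding k_def by (intro continuous_map_compose_lambda[OF h] continuous_map_pairedI continuous_map_fst)
  moreover have "k (b, 0) = (e \<circ> f) b" "k (b, 1) = g b" if "b \<in> topspace B" for b
    using that fX E'(2) G0 by (auto simp: k_def hP \<alpha>_def \<beta>_def P_def unit_clamp_simps)
  ultimately have "homotopy_from_to B X k (e \<circ> f) g"
    by (simp add: homotopy_from_to_def)
  moreover have "k (i a, t) = hA (a, t)" if "a \<in> topspace A" "t \<in> {0..1}" for a t
  proof (cases "t = 0")
    case True
    then show ?thesis
      using that fAX E'(2) hA'(2) by (simp add: k_def hi \<beta>_def N_def unit_clamp_simps)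
  next
    case False
    then show ?thesis
      using that by (auto simp: k_def hi \<beta>_def N_def unit_clamp_simps)
  qed
  ultimately show "\<exists>f h. continuous_map B X f \<and> homotopy_from_to B X h (e \<circ> f) g \<and>
      (\<forall>a\<in>topspace A. f (i a) = fA a) \<and> (\<forall>a\<in>topspace A. \<forall>t\<in>{0..1}. h (i a, t) = hA (a, t))"
    using f fi by blast
qed

text \<open>A solution \<open>f, k\<close> of the problem for \<open>q \<circ> p\<close> obtained by applying \<open>q\<close> leaves the task of
  finding a homotopy from \<open>p \<circ> f\<close> to \<open>g\<close>. The map \<open>p \<circ> k\<close> is one from \<open>p \<circ> q \<circ> p \<circ> f\<close> to \<open>p \<circ> q \<circ> g\<close>,
  which has to be corrected by the homotopy from \<open>p \<circ> q\<close> to the identity: first its ends, then its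
  values on \<open>A\<close>.\<close>

lemma homotopy_equivalence_imp_has_HELP:
  fixes A :: "'a topology" and B :: "'b topology" and X :: "'x topology" and Y :: "'y topology"
  assumes cof: "closed_cofibration A B i" and eqv: "homotopy_equivalence X Y p"
  shows "has_HELP X Y p A B i"
  unfolding has_HELP_def
proof (intro allI impI, elim conjE)
  fix fA g hA
  assume fA: "continuous_map A X fA" and g: "continuous_map B Y g"
    and hA: "homotopy_from_to A Y hA (p \<circ> fA) (g \<circ> i)"
  note hA' = homotopy_from_toD[OF hA]
  obtain q D E where p: "continuous_map X Y p" and q: "continuous_map Y X q"
    and D: "homotopy_from_to X X D (q \<circ> p) id" and E: "homotopy_from_to Y Y E (p \<circ> q) id"
    using eqv by (auto simp: homotopy_equivalence_def homotopic_with_iff_homotopy_from_to)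
  note E' = homotopy_from_toD[OF E]
  have hAY: "hA (a, t) \<in> topspace Y" if "a \<in> topspace A" "0 \<le> t" "t \<le> 1" for a t
    using continuous_map_funspace[OF hA'(1)] that by auto
  have gY: "g b \<in> topspace Y" if "b \<in> topspace B" for b
    using g that by (auto simp: continuous_map_def)
  have "homotopy_from_to A X (q \<circ> hA) ((q \<circ> p) \<circ> fA) ((q \<circ> g) \<circ> i)"
    using hA' continuous_map_compose[OF hA'(1) q] by (auto simp: homotopy_from_to_def)
  then obtain f k where f: "continuous_map B X f"
    and k: "homotopy_from_to B X k ((q \<circ> p) \<circ> f) (q \<circ> g)"
    and fi: "\<And>a. a \<in> topspace A \<Longrightarrow> f (i a) = fA a"
    and ki: "\<And>a t. a \<in> topspace A \<Longrightarrow> t \<in> {0..1} \<Longrightarrow> k (i a, t) = (q \<circ> hA) (a, t)"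
    using has_HELPD[OF has_HELP_homotopic_id[OF cof D] fA continuous_map_compose[OF g q]] by metis
  note k' = homotopy_from_toD[OF k]
  have pf: "continuous_map B Y (\<lambda>b. p (f b))"
    by (rule continuous_map_compose_lambda[OF p f])
  have pfY: "p (f b) \<in> topspace Y" if "b \<in> topspace B" for b
    using pf that by (auto simp: continuous_map_def)
  let ?T = "top_of_set {-1..2::real}"
  have sT: "continuous_map (prod_topology B ?T) euclideanreal snd"
    by (rule continuous_map_into_fulltopology[OF continuous_map_snd])
  \<comment> \<open>\<open>P\<close> leads from \<open>p \<circ> f\<close> backwards along
    \<open>E\<close> to \<open>p \<circ> q \<circ> p \<circ> f\<close> over [-1,0], along
    \<open>p \<circ> k\<close> to \<open>p \<circ> q \<circ> g\<close> over [0,1], and along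
    \<open>E\<close> to \<open>g\<close> over [1,2].\<close>
  define P where "P = (\<lambda>x. if snd x \<le> 0 then E (p (f (fst x)), unit_clamp (- snd x))
      else if snd x \<le> 1 then p (k (fst x, unit_clamp (snd x)))
      else E (g (fst x), unit_clamp (snd x - 1)))"
  have P: "continuous_map (prod_topology B ?T) Y P"
    unfolding P_def
  proof (intro continuous_map_if_le sT)
    show "continuous_map (prod_topology B ?T) Y (\<lambda>x. E (p (f (fst x)), unit_clamp (- snd x)))"
      by (intro continuous_map_homotopy_clamp[OF E'(1)] continuous_map_minus sT
          continuous_map_compose_lambda[OF pf] continuous_map_fst)
    show "continuous_map (prod_topology B ?T) Y (\<lambda>x. p (k (fst x, unit_clamp (snd x))))"
      by (intro continuous_map_compose_lambda[OF p] continuous_map_homotopy_clamp[OF k'(1)] sT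
          continuous_map_fst)
    show "continuous_map (prod_topology B ?T) Y (\<lambda>x. E (g (fst x), unit_clamp (snd x - 1)))"
      by (intro continuous_map_homotopy_clamp[OF E'(1)] continuous_map_diff sT
          continuous_map_compose_lambda[OF g] continuous_map_fst) auto
  qed (use E'(2) k' pfY gY in \<open>auto simp: unit_clamp_simps\<close>)
  have hA_clamp: "continuous_map W Y (\<lambda>w. hA (u w, unit_clamp (v w)))"
    if "continuous_map W A u" "continuous_map W euclideanreal v" for W u v
    by (rule continuous_map_homotopy_clamp[OF hA'(1) that])
  let ?W = "prod_topology (prod_topology A ?T) euclideanreal"
  have W: "continuous_map ?W A (\<lambda>x. fst (fst x))" "continuous_map ?W euclideanreal (\<lambda>x. snd (fst x))"
    by (rule continuous_map_compose_lambda[OF continuous_map_fst continuous_map_fst]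
        continuous_map_compose_lambda[OF continuous_map_into_fulltopology[OF continuous_map_snd] continuous_map_fst])+
  have M: "continuous_map ?W Y (\<lambda>x. E (hA (fst (fst x), unit_clamp (snd (fst x))), unit_clamp (snd x)))"
    by (intro continuous_map_homotopy_clamp[OF E'(1)] hA_clamp W continuous_map_snd)
  \<comment> \<open>Over \<open>A\<close> all three pieces have the form
    \<open>E (hA (a, unit_clamp t), \<alpha> t)\<close>. Since \<open>\<alpha>\<close> is 1 at -1
    and 2, replacing it by the constant 1, where \<open>E\<close> is the identity, preserves the
    ends.\<close>
  define \<alpha> where "\<alpha> t = max 0 (max (- t) (t - 1))" for t :: real
  have \<alpha>: "continuous_map ?T euclideanreal \<alpha>"
    unfolding \<alpha>_def[abs_def] by (simp, intro continuous_intros)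
  have PM: "P (i a, t) = E (hA (fst (fst ((a, t), \<alpha> t)), unit_clamp (snd (fst ((a, t), \<alpha> t)))),
      unit_clamp (snd ((a, t), \<alpha> t)))" if a: "a \<in> topspace A" and t: "t \<in> topspace ?T" for a t
  proof -
    consider "t \<le> 0" | "0 < t" "t \<le> 1" | "1 < t"
      by linarith
    then show ?thesis
    proof cases
      case 1
      then have "\<alpha> t = - t"
        by (simp add: \<alpha>_def)
      then show ?thesis
        using 1 a t hA'(2) fi by (simp add: P_def unit_clamp_simps)
    next
      case 2
      then have "\<alpha> t = 0"
        by (simp add: \<alpha>_def)
      then show ?thesis
        using 2 a t ki E'(2) hAY by (simp add: P_def unit_clamp_simps)
    next
      case 3
      then have "\<alpha> t = t - 1"
        by (simp add: \<alpha>_def)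
      then show ?thesis
        using 3 a t hA'(3) by (simp add: P_def unit_clamp_simps)
    qed
  qed
  obtain h' where h': "continuous_map (prod_topology B ?T) Y h'"
    and h'i: "\<And>a t. a \<in> topspace A \<Longrightarrow> t \<in> topspace ?T \<Longrightarrow>
      h' (i a, t) = E (hA (fst (fst ((a, t), 1)), unit_clamp (snd (fst ((a, t), 1)))), unit_clamp (snd ((a, t), 1::real)))"
    and h'P: "\<And>b t. b \<in> topspace B \<Longrightarrow> t \<in> topspace ?T \<Longrightarrow> \<alpha> t = 1 \<Longrightarrow> h' (b, t) = P (b, t)"
    by (rule closed_cofibration_reparametrize[OF cof M P \<alpha> _ zero_less_one _ PM, of "\<lambda>_. 1"])
      (auto simp: \<alpha>_def)
  \<comment> \<open>Over \<open>A\<close> what remains is \<open>hA\<close> with waiting times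
    before 0 and after 1. \<open>\<beta>\<close> spreads \<open>hA\<close> evenly over [-1,2] and
    agrees with \<open>unit_clamp\<close> at both ends.\<close>
  define \<beta> where "\<beta> t = (t + 1) / 3" for t :: real
  have c: "continuous_map ?T euclideanreal unit_clamp" "continuous_map ?T euclideanreal \<beta>"
    unfolding unit_clamp_def[abs_def] \<beta>_def[abs_def] by (simp_all, (intro continuous_intros | simp)+)
  have M': "continuous_map ?W Y (\<lambda>x. hA (fst (fst x), unit_clamp (snd x)))"
    by (intro hA_clamp W continuous_map_snd)
  have h'M: "h' (i a, t) = hA (fst (fst ((a, t), unit_clamp t)), unit_clamp (snd ((a, t), unit_clamp t)))"
    if "a \<in> topspace A" "t \<in> topspace ?T" for a t
    using that h'i E'(3) hAY unit_clamp_bounds[of t] by (simp add: unit_clamp_simps)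
  have bd: "\<bar>\<beta> t - unit_clamp t\<bar> \<le> 1" if "t \<in> topspace ?T" for t
    using that unit_clamp_bounds[of t] by (simp add: \<beta>_def abs_le_iff field_simps)
  obtain h where h: "continuous_map (prod_topology B ?T) Y h"
    and hi: "\<And>a t. a \<in> topspace A \<Longrightarrow> t \<in> topspace ?T \<Longrightarrow>
      h (i a, t) = hA (fst (fst ((a, t), \<beta> t)), unit_clamp (snd ((a, t), \<beta> t)))"
    and hh': "\<And>b t. b \<in> topspace B \<Longrightarrow> t \<in> topspace ?T \<Longrightarrow> unit_clamp t = \<beta> t \<Longrightarrow> h (b, t) = h' (b, t)"
    using closed_cofibration_reparametrize[OF cof M' h' c zero_less_one bd h'M] by blast
  define l where "l = (\<lambda>x. h (fst x, 3 * snd x - 1))"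
  have "continuous_map (prod_topology B unit_interval) ?T (\<lambda>x. 3 * snd x - 1)"
    by (auto simp: continuous_map_in_subtopology
        intro!: continuous_map_diff continuous_map_real_mult_left continuous_map_into_fulltopology[OF continuous_map_snd])
  then have "continuous_map (prod_topology B unit_interval) Y l"
    unfolding l_def by (intro continuous_map_compose_lambda[OF h] continuous_map_pairedI continuous_map_fst)
  moreover have "l (b, 0) = (p \<circ> f) b" "l (b, 1) = g b" if "b \<in> topspace B" for b
    using that pfY gY E'(3) by (auto simp: l_def hh' h'P \<alpha>_def \<beta>_def P_def unit_clamp_simps)
  ultimately have "homotopy_from_to B Y l (p \<circ> f) g"
    by (simp add: homotopy_from_to_def)
  moreover have "l (i a, t) = hA (a, t)" if "a \<in> topspace A" "t \<in> {0..1}" for a t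
    using that by (auto simp: l_def hi \<beta>_def unit_clamp_simps)
  ultimately show "\<exists>f h. continuous_map B X f \<and> homotopy_from_to B Y h (p \<circ> f) g \<and>
      (\<forall>a\<in>topspace A. f (i a) = fA a) \<and> (\<forall>a\<in>topspace A. \<forall>t\<in>{0..1}. h (i a, t) = hA (a, t))"
    using f fi by blast
qed

section \<open>The two test cofibrations\<close>

text \<open>Nothing is prescribed on the empty space, so the constant homotopy is an
  extension.\<close>

lemma closed_cofibration_empty:
  fixes A :: "'a topology" and B :: "'b topology"
  assumes "topspace A = {}"
  shows "closed_cofibration A B i"
proof -
  have "has_HEP A B i Z" for Z :: "('a \<times> real + 'b) topology"
    unfolding has_HEP_def
  proof (intro allI impI, elim conjE)
    fix f :: "'b \<Rightarrow> 'a \<times> real + 'b" and h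
    assume f: "continuous_map B Z f"
    have "continuous_map (prod_topology B unit_interval) Z (\<lambda>x. f (fst x))"
      by (rule continuous_map_compose_lambda[OF f continuous_map_fst])
    then show "\<exists>k. continuous_map (prod_topology B unit_interval) Z k \<and>
        (\<forall>b\<in>topspace B. k (b, 0) = f b) \<and> (\<forall>a\<in>topspace A. \<forall>t\<in>{0..1}. k (i a, t) = h (a, t))"
      using assms by (intro exI[of _ "\<lambda>x. f (fst x)"]) auto
  qed
  moreover have "A = trivial_topology"
    using assms by simp
  then have "embedding_map A B i"
    by (simp add: embedding_map_def homeomorphic_eq_everything_map open_map_on_empty closed_map_on_empty)
  ultimately show ?thesis
    using assms unfolding closed_cofibration_def hurewicz_cofibration_def
    by (auto simp: closed_map_def closedin_topspace_empty)
qed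

lemma embedding_map_subtopology_id: "embedding_map (subtopology X S) X id"
  by (simp add: embedding_map_def subtopology_restrict)

text \<open>The homotopies on the two ends of the cylinder are pushed in along the collars of width \<open>t/3\<close>.\<close>

lemma closed_cofibration_cylinder_ends:
  fixes X :: "'a topology"
  shows "closed_cofibration (subtopology (prod_topology X unit_interval) (UNIV \<times> {0, 1}))
     (prod_topology X unit_interval) id"
proof -
  let ?C = "prod_topology X unit_interval"
  let ?A = "subtopology ?C (UNIV \<times> {0, 1})"
  have "has_HEP ?A ?C id Z" for Z :: "(('a \<times> real) \<times> real + 'a \<times> real) topology"
    unfolding has_HEP_def
  proof (intro allI impI, elim conjE)
    fix F :: "'a \<times> real \<Rightarrow> ('a \<times> real) \<times> real + 'a \<times> real" and H
    assume F: "continuous_map ?C Z F" and H: "continuous_map (prod_topology ?A unit_interval) Z H"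
      and "\<forall>a\<in>topspace ?A. H (a, 0) = F (id a)"
    then have HF: "H ((x, 0), 0) = F (x, 0)" "H ((x, 1), 0) = F (x, 1)" if "x \<in> topspace X" for x
      using that by auto
    have H': "continuous_map ?C Z (\<lambda>y. H ((fst y, e), snd y))" if "e \<in> {0, 1}" for e
    proof (rule continuous_map_compose_lambda[OF H])
      have "continuous_map ?C ?C (\<lambda>y. (fst y, e))"
        using that by (intro continuous_map_pairedI continuous_map_fst) auto
      then show "continuous_map ?C (prod_topology ?A unit_interval) (\<lambda>y. ((fst y, e), snd y))"
        using that by (intro continuous_map_pairedI continuous_map_snd) (auto simp: continuous_map_in_subtopology)
    qed
    let ?W = "prod_topology ?C unit_interval"
    have x: "continuous_map ?W X (\<lambda>w. fst (fst w))"
      by (rule continuous_map_compose_lambda[OF continuous_map_fst continuous_map_fst])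
    have s: "continuous_map ?W euclideanreal (\<lambda>w. snd (fst w))"
      by (rule continuous_map_compose_lambda[OF continuous_map_into_fulltopology[OF continuous_map_snd] continuous_map_fst])
    have t: "continuous_map ?W euclideanreal snd"
      by (rule continuous_map_into_fulltopology[OF continuous_map_snd])
    have v: "continuous_map ?W euclideanreal (\<lambda>w. 3 * snd (fst w) - snd w)"
      "continuous_map ?W euclideanreal (\<lambda>w. 3 * (1 - snd (fst w)) - snd w)"
      by (intro continuous_map_diff continuous_map_real_mult_left s t; simp)+
    \<comment> \<open>With height \<open>s\<close> and time \<open>t\<close>, the tests are
      \<open>s \<le> t/3\<close> and \<open>1 - s \<le> t/3\<close>. On the collars \<open>H\<close>
      is taken at time \<open>t - 3 * s\<close> or \<open>t - 3 * (1 - s)\<close>, which is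
      \<open>t\<close> at the end and 0 at the inner boundary. The remaining interval from
      \<open>t/3\<close> to \<open>1 - t/3\<close> is stretched linearly onto [0,1] and carries
      \<open>F\<close>.\<close>
    define k where "k = (\<lambda>w. if 3 * snd (fst w) - snd w \<le> 0
        then H ((fst (fst w), 0), unit_clamp (- (3 * snd (fst w) - snd w)))
      else if 3 * (1 - snd (fst w)) - snd w \<le> 0
        then H ((fst (fst w), 1), unit_clamp (- (3 * (1 - snd (fst w)) - snd w)))
      else F (fst (fst w), unit_clamp ((3 * snd (fst w) - snd w) / (3 - 2 * snd w))))"
    have "continuous_map ?W Z k"
      unfolding k_def
    proof (intro continuous_map_if_le v)
      show "continuous_map ?W Z (\<lambda>w. H ((fst (fst w), 0), unit_clamp (- (3 * snd (fst w) - snd w))))"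
        using continuous_map_homotopy_clamp[OF H'[of 0] x continuous_map_minus[OF v(1)]] by simp
      show "continuous_map ?W Z (\<lambda>w. H ((fst (fst w), 1), unit_clamp (- (3 * (1 - snd (fst w)) - snd w))))"
        using continuous_map_homotopy_clamp[OF H'[of 1] x continuous_map_minus[OF v(2)]] by simp
      have "continuous_map ?W euclideanreal (\<lambda>w. (3 * snd (fst w) - snd w) / (3 - 2 * snd w))"
        by (intro continuous_map_real_divide v continuous_map_diff continuous_map_real_mult_left t) auto
      then show "continuous_map ?W Z
          (\<lambda>w. F (fst (fst w), unit_clamp ((3 * snd (fst w) - snd w) / (3 - 2 * snd w))))"
        by (rule continuous_map_homotopy_clamp[OF F x])
    next
      fix w assume w: "w \<in> topspace ?W" "3 * (1 - snd (fst w)) - snd w = 0"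
      then have "(3 * snd (fst w) - snd w) / (3 - 2 * snd w) = 1"
        by (auto simp: field_simps)
      then show "H ((fst (fst w), 1), unit_clamp (- (3 * (1 - snd (fst w)) - snd w))) =
          F (fst (fst w), unit_clamp ((3 * snd (fst w) - snd w) / (3 - 2 * snd w)))"
        using w HF by (auto simp: unit_clamp_simps)
    next
      \<comment> \<open>As \<open>t \<le> 1\<close>, the collars are disjoint, so on this seam the
        lower collar meets the middle piece only.\<close>
      fix w assume w: "w \<in> topspace ?W" "3 * snd (fst w) - snd w = 0"
      then have "\<not> 3 * (1 - snd (fst w)) - snd w \<le> 0"
        by auto
      then show "H ((fst (fst w), 0), unit_clamp (- (3 * snd (fst w) - snd w))) =
          (if 3 * (1 - snd (fst w)) - snd w \<le> 0
           then H ((fst (fst w), 1), unit_clamp (- (3 * (1 - snd (fst w)) - snd w)))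
           else F (fst (fst w), unit_clamp ((3 * snd (fst w) - snd w) / (3 - 2 * snd w))))"
        using w HF by (auto simp: unit_clamp_simps)
    qed
    moreover have "k (b, 0) = F b" if b: "b \<in> topspace ?C" for b
    proof -
      obtain y r where "b = (y, r)" "y \<in> topspace X" "0 \<le> r" "r \<le> 1"
        using b by auto
      then show ?thesis
        using HF by (cases "r = 0"; cases "r = 1") (auto simp: k_def unit_clamp_simps)
    qed
    moreover have "k (id a, t) = H (a, t)" if "a \<in> topspace ?A" "t \<in> {0..1}" for a t
      using that by (auto simp: k_def unit_clamp_simps)
    ultimately show "\<exists>k. continuous_map ?W Z k \<and> (\<forall>b\<in>topspace ?C. k (b, 0) = F b) \<and>
        (\<forall>a\<in>topspace ?A. \<forall>t\<in>{0..1}. k (id a, t) = H (a, t))"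
      by blast
  qed
  moreover have "closedin ?C {x \<in> topspace ?C. snd x \<in> {0, 1}}"
    by (rule closedin_continuous_map_preimage[OF continuous_map_into_fulltopology[OF continuous_map_snd]]) simp
  then have "closedin ?C (topspace ?C \<inter> (UNIV \<times> {0, 1}))"
    by (rule back_subst[of "closedin ?C"]) auto
  then have "closed_map ?A ?C id"
    by (simp only: closed_map_inclusion_eq)
  moreover have "embedding_map ?A ?C id"
    by (rule embedding_map_subtopology_id)
  moreover have "continuous_map ?A ?C id"
    by (rule continuous_map_from_subtopology[OF continuous_map_id])
  ultimately show ?thesis
    by (simp only: closed_cofibration_def hurewicz_cofibration_def) blast
qed

section \<open>Change of carrier types\<close>

text \<open>Extension problems are conjugated by the homeomorphisms. Their targets live over the sum
  type of the new carriers, so the extension property of \<open>i\<close> is needed for targets over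
  a foreign type.\<close>

lemma closed_cofibration_homeomorphic:
  fixes A :: "'a topology" and B :: "'b topology" and A' :: "'c topology" and B' :: "'d topology"
  assumes a: "homeomorphic_maps A A' a a'" and b: "homeomorphic_maps B B' b b'"
    and cof: "closed_cofibration A B i"
  shows "closed_cofibration A' B' (b \<circ> i \<circ> a')"
proof -
  have a': "continuous_map A A' a" "continuous_map A' A a'" "\<And>x. x \<in> topspace A' \<Longrightarrow> a (a' x) = x"
    and b': "continuous_map B B' b" "continuous_map B' B b'" "\<And>x. x \<in> topspace B \<Longrightarrow> b' (b x) = x"
    "\<And>x. x \<in> topspace B' \<Longrightarrow> b (b' x) = x"
    using a b by (auto simp: homeomorphic_maps_def)
  have i: "continuous_map A B i"
    by (rule closed_cofibration_imp_continuous_map[OF cof])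
  have mem: "a' x \<in> topspace A" "i (a' x) \<in> topspace B" if "x \<in> topspace A'" for x
    using that a'(2) i by (auto simp: continuous_map_def)
  have b'B: "b' x \<in> topspace B" if "x \<in> topspace B'" for x
    using that b'(2) by (auto simp: continuous_map_def)
  have "has_HEP A' B' (b \<circ> i \<circ> a') Z" for Z :: "('c \<times> real + 'd) topology"
    unfolding has_HEP_def
  proof (intro allI impI, elim conjE)
    fix F :: "'d \<Rightarrow> 'c \<times> real + 'd" and H
    assume F: "continuous_map B' Z F" and H: "continuous_map (prod_topology A' unit_interval) Z H"
      and HF: "\<forall>x\<in>topspace A'. H (x, 0) = F ((b \<circ> i \<circ> a') x)"
    have F': "continuous_map B Z (\<lambda>y. F (b y))"
      by (rule continuous_map_compose_lambda[OF F b'(1)])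
    have H': "continuous_map (prod_topology A unit_interval) Z (\<lambda>x. H (a (fst x), snd x))"
      by (intro continuous_map_compose_lambda[OF H] continuous_map_pairedI continuous_map_snd
          continuous_map_compose_lambda[OF a'(1)] continuous_map_fst)
    have HF': "H (a (fst (x, 0)), snd (x, 0)) = F (b (i x))" if "x \<in> topspace A" for x
    proof -
      have "a' (a x) = x" "a x \<in> topspace A'"
        using a that by (auto simp: homeomorphic_maps_def continuous_map_def)
      then show ?thesis
        using bspec[OF HF, of "a x"] by simp
    qed
    obtain k where k: "continuous_map (prod_topology B unit_interval) Z k"
      and k0: "\<And>y. y \<in> topspace B \<Longrightarrow> k (y, 0) = F (b y)"
      and ki: "\<And>x t. x \<in> topspace A \<Longrightarrow> 0 \<le> t \<Longrightarrow> t \<le> 1 \<Longrightarrow> k (i x, t) = H (a (fst (x, t)), snd (x, t))"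
      by (rule has_HEPD[OF closed_cofibration_imp_HEP[OF cof] F' H' HF']) (assumption, rule that)
    have "continuous_map (prod_topology B' unit_interval) Z (\<lambda>y. k (b' (fst y), snd y))"
      by (intro continuous_map_compose_lambda[OF k] continuous_map_pairedI continuous_map_snd
          continuous_map_compose_lambda[OF b'(2)] continuous_map_fst)
    then show "\<exists>k. continuous_map (prod_topology B' unit_interval) Z k \<and>
        (\<forall>y\<in>topspace B'. k (y, 0) = F y) \<and>
        (\<forall>x\<in>topspace A'. \<forall>t\<in>{0..1}. k ((b \<circ> i \<circ> a') x, t) = H (x, t))"
      using k0 ki a'(3) b' mem b'B by (intro exI[of _ "\<lambda>y. k (b' (fst y), snd y)"]) auto
  qed
  moreover have ha: "homeomorphic_map A' A a'" and hb: "homeomorphic_map B B' b"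
    using a b homeomorphic_map_maps homeomorphic_maps_sym by blast+
  have "embedding_map A' A a'" "embedding_map A B i" "embedding_map B B' b"
    using ha hb cof surjective_embedding_map by (auto simp: closed_cofibration_def)
  then have "embedding_map A' B' (b \<circ> i \<circ> a')"
    by (intro embedding_map_compose)
  moreover have "closed_map A' A a'" "closed_map A B i" "closed_map B B' b"
    using ha hb cof homeomorphic_imp_closed_map by (auto simp: closed_cofibration_def)
  then have "closed_map A' B' (b \<circ> i \<circ> a')"
    by (intro closed_map_compose)
  moreover have "continuous_map A' B' (b \<circ> i \<circ> a')"
    using a'(2) b'(1) i by (intro continuous_map_compose)
  ultimately show ?thesis
    by (simp add: closed_cofibration_def hurewicz_cofibration_def)
qed

lemma has_HELP_homeomorphic:
  assumes a: "homeomorphic_maps A A' a a'" and b: "homeomorphic_maps B B' b b'"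
    and i: "continuous_map A B i" and HELP: "has_HELP X Y p A' B' (b \<circ> i \<circ> a')"
  shows "has_HELP X Y p A B i"
  unfolding has_HELP_def
proof (intro allI impI, elim conjE)
  fix fA g hA
  assume fA: "continuous_map A X fA" and g: "continuous_map B Y g"
    and hA: "homotopy_from_to A Y hA (p \<circ> fA) (g \<circ> i)"
  note hA' = homotopy_from_toD[OF hA]
  have a': "continuous_map A A' a" "continuous_map A' A a'" "\<And>x. x \<in> topspace A \<Longrightarrow> a' (a x) = x"
    and b': "continuous_map B B' b" "continuous_map B' B b'" "\<And>x. x \<in> topspace B \<Longrightarrow> b' (b x) = x"
    using a b by (auto simp: homeomorphic_maps_def)
  have mem: "a' x \<in> topspace A" "i (a' x) \<in> topspace B" if "x \<in> topspace A'" for x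
    using that a'(2) i by (auto simp: continuous_map_def)
  have mem': "a x \<in> topspace A'" if "x \<in> topspace A" for x
    using that a'(1) by (auto simp: continuous_map_def)
  have memB: "b y \<in> topspace B'" if "y \<in> topspace B" for y
    using that b'(1) by (auto simp: continuous_map_def)
  have "continuous_map (prod_topology A' unit_interval) Y (\<lambda>x. hA (a' (fst x), snd x))"
    by (intro continuous_map_compose_lambda[OF hA'(1)] continuous_map_pairedI continuous_map_snd
        continuous_map_compose_lambda[OF a'(2)] continuous_map_fst)
  then have "homotopy_from_to A' Y (\<lambda>x. hA (a' (fst x), snd x)) (p \<circ> (fA \<circ> a')) ((g \<circ> b') \<circ> (b \<circ> i \<circ> a'))"
    using hA' mem b'(3) by (simp add: homotopy_from_to_def)
  then obtain f h where f: "continuous_map B' X f" and h: "homotopy_from_to B' Y h (p \<circ> f) (g \<circ> b')"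
    and fi: "\<And>x. x \<in> topspace A' \<Longrightarrow> f ((b \<circ> i \<circ> a') x) = (fA \<circ> a') x"
    and hi: "\<And>x t. x \<in> topspace A' \<Longrightarrow> t \<in> {0..1} \<Longrightarrow> h ((b \<circ> i \<circ> a') x, t) = hA (a' (fst (x, t)), snd (x, t))"
    by (rule has_HELPD[OF HELP continuous_map_compose[OF a'(2) fA] continuous_map_compose[OF b'(2) g]])
      (auto intro: that)
  note h' = homotopy_from_toD[OF h]
  have "continuous_map (prod_topology B unit_interval) Y (\<lambda>y. h (b (fst y), snd y))"
    by (intro continuous_map_compose_lambda[OF h'(1)] continuous_map_pairedI continuous_map_snd
        continuous_map_compose_lambda[OF b'(1)] continuous_map_fst)
  then have "homotopy_from_to B Y (\<lambda>y. h (b (fst y), snd y)) (p \<circ> (f \<circ> b)) g"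
    using h' memB b'(3) by (simp add: homotopy_from_to_def)
  moreover have "(f \<circ> b) (i x) = fA x" if "x \<in> topspace A" for x
    using that fi[OF mem'[OF that]] a'(3) by simp
  moreover have "h (b (fst (i x, t)), snd (i x, t)) = hA (x, t)" if "x \<in> topspace A" "t \<in> {0..1}" for x t
    using that hi[OF mem'[OF that(1)] that(2)] a'(3) by simp
  ultimately show "\<exists>f h. continuous_map B X f \<and> homotopy_from_to B Y h (p \<circ> f) g \<and>
      (\<forall>x\<in>topspace A. f (i x) = fA x) \<and> (\<forall>x\<in>topspace A. \<forall>t\<in>{0..1}. h (i x, t) = hA (x, t))"
    using continuous_map_compose[OF b'(1) f] by blast
qed

lemma homeomorphic_maps_pullback_topology:
  assumes "inj j"
  shows "homeomorphic_maps A (pullback_topology (range j) (inv j) A) j (inv j)"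
proof -
  have "inv j \<circ> j = id"
    using assms by simp
  then have "continuous_map A (pullback_topology (range j) (inv j) A) j"
    by (intro continuous_map_pullback') auto
  moreover have "continuous_map (pullback_topology (range j) (inv j) A) A (inv j)"
    using continuous_map_pullback[OF continuous_map_id, of "range j" "inv j" A] by simp
  ultimately show ?thesis
    using assms by (auto simp: homeomorphic_maps_def topspace_pullback_topology)
qed

text \<open>The cofibration is copied onto the ranges of the injections; a solution for the copy is
  pulled back. Thus HELP over one carrier type can be used for the spaces that the converse
  needs.\<close>

lemma has_HELP_of_larger_carrier:
  fixes A :: "'a topology" and B :: "'b topology" and j :: "'a \<Rightarrow> 'c" and k :: "'b \<Rightarrow> 'd"
  assumes "inj j" "inj k"
    and HELP: "\<And>(A' :: 'c topology) (B' :: 'd topology) i. closed_cofibration A' B' i \<Longrightarrow> has_HELP X Y p A' B' i"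
    and cof: "closed_cofibration A B i"
  shows "has_HELP X Y p A B i"
proof -
  note h = homeomorphic_maps_pullback_topology[OF assms(1), of A]
    homeomorphic_maps_pullback_topology[OF assms(2), of B]
  show ?thesis
    by (rule has_HELP_homeomorphic[OF h closed_cofibration_imp_continuous_map[OF cof]])
      (rule HELP[OF closed_cofibration_homeomorphic[OF h cof]])
qed

section \<open>From HELP to a homotopy equivalence\<close>

text \<open>HELP for \<open>\<emptyset> \<rightarrow> Y\<close> and \<open>g = id\<close> yields a right homotopy inverse \<open>q\<close>. HELP for
  \<open>X \<times> {0,1} \<rightarrow> X \<times> [0,1]\<close>, with \<open>q \<circ> p\<close> and \<open>id\<close> prescribed on the ends, yields a homotopy between them.\<close>

lemma has_HELP_imp_homotopy_equivalence:
  fixes X :: "'x topology" and Y :: "'y topology"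
  assumes p: "continuous_map X Y p"
    and help1: "has_HELP X Y p (trivial_topology :: 'y topology) Y id"
    and help2: "has_HELP X Y p (subtopology (prod_topology X unit_interval) (UNIV \<times> {0, 1}))
      (prod_topology X unit_interval) id"
  shows "homotopy_equivalence X Y p"
proof -
  obtain q K where q: "continuous_map Y X q" and K: "homotopy_from_to Y Y K (p \<circ> q) id"
  proof -
    \<comment> \<open>Maps out of the empty space may take any value.\<close>
    let ?u = "\<lambda>_ :: 'y. undefined :: 'x" and ?v = "\<lambda>_ :: 'y \<times> real. undefined :: 'y"
    have u: "continuous_map (trivial_topology :: 'y topology) X ?u"
      "homotopy_from_to (trivial_topology :: 'y topology) Y ?v (p \<circ> ?u) (id \<circ> id)"
      by (simp_all add: homotopy_from_to_def)
    show thesis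
      by (rule has_HELPD[OF help1 u(1) continuous_map_id u(2)]) (rule that)
  qed
  note K' = homotopy_from_toD[OF K]
  let ?C = "prod_topology X unit_interval"
  let ?A = "subtopology ?C (UNIV \<times> {0, 1})"
  \<comment> \<open>On \<open>?A\<close> the second coordinate is 0 or 1, so the cutoff 1/2
    separates the two ends and nothing has to match there.\<close>
  define fA where "fA y = (if snd y \<le> 1/2 then q (p (fst y)) else fst y)" for y :: "'x \<times> real"
  \<comment> \<open>On the end 0 this is \<open>K\<close> from \<open>p \<circ> q \<circ> p\<close>
    to \<open>p\<close>, on the end 1 the constant homotopy at \<open>p\<close>.\<close>
  define hA where "hA z = (if snd (fst z) \<le> 1/2 then K (p (fst (fst z)), unit_clamp (snd z)) else p (fst (fst z)))"
    for z :: "('x \<times> real) \<times> real"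
  have A: "continuous_map ?A X fst" "continuous_map ?A euclideanreal snd"
    by (intro continuous_map_from_subtopology continuous_map_fst
        continuous_map_into_fulltopology[OF continuous_map_snd])+
  have "continuous_map ?A X fA"
    unfolding fA_def
    by (intro continuous_map_if_le A continuous_map_compose_lambda[OF q] continuous_map_compose_lambda[OF p]) auto
  moreover have g: "continuous_map ?C Y (\<lambda>y. p (fst y))"
    by (rule continuous_map_compose_lambda[OF p continuous_map_fst])
  moreover have "homotopy_from_to ?A Y hA (p \<circ> fA) ((\<lambda>y. p (fst y)) \<circ> id)"
  proof -
    let ?W = "prod_topology ?A unit_interval"
    have W: "continuous_map ?W Y (\<lambda>z. p (fst (fst z)))"
      by (rule continuous_map_compose_lambda[OF continuous_map_compose_lambda[OF p A(1)] continuous_map_fst])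
    have "continuous_map ?W Y hA"
      unfolding hA_def
      by (intro continuous_map_if_le W continuous_map_homotopy_clamp[OF K'(1)]
          continuous_map_compose_lambda[OF A(2)] continuous_map_fst
          continuous_map_into_fulltopology[OF continuous_map_snd]) auto
    moreover have "p x \<in> topspace Y" if "x \<in> topspace X" for x
      using p that by (auto simp: continuous_map_def)
    ultimately show ?thesis
      using K'(2,3) by (auto simp: homotopy_from_to_def hA_def fA_def unit_clamp_simps)
  qed
  ultimately obtain f where f: "continuous_map ?C X f" and fi: "\<And>y. y \<in> topspace ?A \<Longrightarrow> f (id y) = fA y"
    by (rule has_HELPD[OF help2]) (rule that)
  have "f (x, 0) = (q \<circ> p) x" "f (x, 1) = id x" if "x \<in> topspace X" for x
    using that fi[of "(x, 0)"] fi[of "(x, 1)"] by (auto simp: fA_def)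
  then have "homotopy_from_to X X f (q \<circ> p) id"
    using f by (simp add: homotopy_from_to_def)
  then show ?thesis
    using p q K by (auto simp: homotopy_equivalence_def homotopic_with_iff_homotopy_from_to)
qed

theorem mainTheorem2:
  fixes X :: "'x topology" and Y :: "'y topology" and p :: "'x \<Rightarrow> 'y"
  assumes "continuous_map X Y p"
  shows
    "(homotopy_equivalence X Y p \<longleftrightarrow>
        (\<forall>(A :: ('x \<times> real + 'y) topology) (B :: ('x \<times> real + 'y) topology) i.
           closed_cofibration A B i \<longrightarrow> has_HELP X Y p A B i)) \<and>
     (homotopy_equivalence X Y p \<longrightarrow>
        (\<forall>(A :: 'a topology) (B :: 'b topology) i.
           closed_cofibration A B i \<longrightarrow> has_HELP X Y p A B i))"
proof (intro conjI iffI impI allI)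
  assume HELP: "\<forall>(A :: ('x \<times> real + 'y) topology) (B :: ('x \<times> real + 'y) topology) i.
      closed_cofibration A B i \<longrightarrow> has_HELP X Y p A B i"
  show "homotopy_equivalence X Y p"
  proof (rule has_HELP_imp_homotopy_equivalence[OF assms])
    show "has_HELP X Y p (trivial_topology :: 'y topology) Y id"
      by (rule has_HELP_of_larger_carrier[of "Inr :: 'y \<Rightarrow> 'x \<times> real + 'y" "Inr :: 'y \<Rightarrow> 'x \<times> real + 'y"])
        (simp_all add: HELP closed_cofibration_empty)
    show "has_HELP X Y p (subtopology (prod_topology X unit_interval) (UNIV \<times> {0, 1}))
        (prod_topology X unit_interval) id"
      by (rule has_HELP_of_larger_carrier[of "Inl :: 'x \<times> real \<Rightarrow> 'x \<times> real + 'y" "Inl :: 'x \<times> real \<Rightarrow> 'x \<times> real + 'y"])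
        (simp_all only: HELP closed_cofibration_cylinder_ends inj_Inl)
  qed
qed (rule homotopy_equivalence_imp_has_HELP; assumption)+

end
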